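(* Let $a<b$ be real numbers and let $F\in C^1([a,b]\times\mathbb{R}^2)$ be a real-valued function, written $F=F(x,p,q)$. Let $(x_0,p_0,q_0)$ be such that $x_0\in(a,b)$, $p_0,q_0\in\mathbb{R}$, $F(x_0,p_0,q_0)=0$ and $\partial_p F(x_0,p_0,q_0)\neq 0$. Then there exist $\delta>0$, $\rho>0$ and a function $\psi\in C^0([x_0-\delta,x_0+\delta]\times[q_0-\rho,q_0+\rho])$ such that $\psi(x_0,q_0)=p_0$ and $$F(x,\psi(x,q),q)=0\qquad\text{for all }(x,q)\in[x_0-\delta,x_0+\delta]\times[q_0-\rho,q_0+\rho].$$ Moreover, if for some $\sigma$ with $0<\sigma<\delta$ there exists a solution $u\in C^1([x_0-\sigma,x_0+\sigma])$ of the problem $$y(x)=\psi(x,y'(x))\quad\text{for } x\in[x_0-\sigma,x_0+\sigma],\qquad y'(x_0)=q_0,$$ then $$F(x,u(x),u'(x))=0\qquad\text{for all }x\in[x_0-\sigma,x_0+\sigma].$$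
   Context: The ordinary differential equation under consideration is $F(x,y(x),y'(x))=0$ on $[a,b]$, with real-valued unknown $y$. $\partial_p F$ denotes the partial derivative of $F(x,p,q)$ with respect to its second variable $p$. The interval $[x_0-\delta,x_0+\delta]$ is understood to be contained in $[a,b]$. That $u$ solves $y(x)=\psi(x,y'(x))$ on $[x_0-\sigma,x_0+\sigma]$ includes that $\psi(x,u'(x))$ is defined, i.e. $u'(x)\in[q_0-\rho,q_0+\rho]$ for all $x$ in that interval. *)

theory Defs
  imports "HOL-Analysis.Analysis"
begin

(* Derivatives are taken within S, hence one-sided at boundary points; this is the usual C^1
   on sets such as closed intervals or [a,b] x R^2, where derivatives within S are unique.
   The library's C1_differentiable_on instead demands two-sided derivatives at every point. *)
definition C1_on :: "('a::real_normed_vector \<Rightarrow> 'b::real_normed_vector) \<Rightarrow> 'a set \<Rightarrow> bool" where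
  "C1_on f S \<longleftrightarrow>
     (\<exists>f' :: 'a \<Rightarrow> 'a \<Rightarrow>\<^sub>L 'b.
        (\<forall>z\<in>S. (f has_derivative blinfun_apply (f' z)) (at z within S)) \<and> continuous_on S f')"

end

theory Submission
  imports Defs
begin

text \<open>
  Near \<open>(x\<^sub>0, p\<^sub>0, q\<^sub>0)\<close> the function \<open>F\<close> is strictly monotone in \<open>p\<close>, so \<open>\<psi>(x, q)\<close> is the unique
  zero of \<open>F(x, \<cdot>, q)\<close> between two fixed values of \<open>p\<close> at which \<open>F\<close> has opposite signs.
  Uniqueness and the persistence of strict signs give continuity of \<open>\<psi>\<close>. The claim about
  solutions of \<open>y = \<psi>(x, y')\<close> is then a substitution.
\<close>

text \<open>The intermediate value theorem gives a zero of each \<open>G z\<close>. By strict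
  monotonicity, \<open>p\<close> lies below or above \<open>\<psi> z\<close> according to the sign
  of \<open>G z p\<close>. For fixed \<open>p\<close> a strict sign persists for nearby
  \<open>z\<close> in \<open>S\<close>, so lower and upper bounds on \<open>\<psi>\<close> persist
  as well; hence continuity in each variable separately is enough.\<close>

lemma strict_mono_implicit_function:
  fixes G :: "'a::topological_space \<Rightarrow> real \<Rightarrow> real"
  assumes lh: "l \<le> h"
    and contz: "\<And>p. p \<in> {l..h} \<Longrightarrow> continuous_on S (\<lambda>z. G z p)"
    and contp: "\<And>z. z \<in> S \<Longrightarrow> continuous_on {l..h} (G z)"
    and mono: "\<And>z. z \<in> S \<Longrightarrow> strict_mono_on {l..h} (G z)"
    and neg: "\<And>z. z \<in> S \<Longrightarrow> G z l < 0"
    and pos: "\<And>z. z \<in> S \<Longrightarrow> 0 < G z h"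
  obtains \<psi> where "continuous_on S \<psi>"
    and "\<And>z. z \<in> S \<Longrightarrow> \<psi> z \<in> {l<..<h}" and "\<And>z. z \<in> S \<Longrightarrow> G z (\<psi> z) = 0"
proof -
  have "\<exists>p. p \<in> {l<..<h} \<and> G z p = 0" if z: "z \<in> S" for z
  proof -
    obtain p where p: "l \<le> p" "p \<le> h" "G z p = 0"
      using IVT'[of "G z" l 0 h] neg[OF z] pos[OF z] lh contp[OF z] by force
    then have "p \<noteq> l" "p \<noteq> h"
      using neg[OF z] pos[OF z] by auto
    with p show ?thesis
      by force
  qed
  then obtain \<psi> where \<psi>: "\<And>z. z \<in> S \<Longrightarrow> \<psi> z \<in> {l<..<h}"
    and zero: "\<And>z. z \<in> S \<Longrightarrow> G z (\<psi> z) = 0"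
    by metis
  have less_iff: "p < \<psi> z \<longleftrightarrow> G z p < 0" "\<psi> z < p \<longleftrightarrow> 0 < G z p"
    if "z \<in> S" "p \<in> {l..h}" for z p
    using strict_mono_on_less[OF mono[OF that(1)], of p "\<psi> z"]
      strict_mono_on_less[OF mono[OF that(1)], of "\<psi> z" p] \<psi>[OF that(1)] zero[OF that(1)] that(2)
    by auto
  have "continuous_on S \<psi>"
    unfolding continuous_on_def
  proof (intro ballI order_tendstoI)
    fix z c assume z: "z \<in> S" and c: "c < \<psi> z"
    \<comment> \<open>\<open>c\<close> may lie below \<open>l\<close>, where nothing is known about
      \<open>G\<close>. Clamping it to the interval keeps it strictly below \<open>\<psi> z\<close>,
      because \<open>l < \<psi> z\<close>.\<close>
    define p where "p = max c l"
    have p: "p \<in> {l..h}" "p < \<psi> z"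
      using c \<psi>[OF z] by (auto simp: p_def)
    then have "G z p < 0"
      using less_iff z by blast
    moreover have "((\<lambda>w. G w p) \<longlongrightarrow> G z p) (at z within S)"
      using contz[OF p(1)] z by (simp add: continuous_on_def)
    ultimately have "\<forall>\<^sub>F w in at z within S. G w p < 0"
      by (metis order_tendstoD(2))
    moreover have "\<forall>\<^sub>F w in at z within S. w \<in> S"
      by (simp add: eventually_at_filter)
    ultimately show "\<forall>\<^sub>F w in at z within S. c < \<psi> w"
    proof eventually_elim
      case (elim w)
      then show ?case
        using less_iff(1)[of w p] p(1) by (simp add: p_def)
    qed
  next
    fix z c assume z: "z \<in> S" and c: "\<psi> z < c"
    define p where "p = min c h"
    have p: "p \<in> {l..h}" "\<psi> z < p"
      using c \<psi>[OF z] by (auto simp: p_def)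
    then have "0 < G z p"
      using less_iff z by blast
    moreover have "((\<lambda>w. G w p) \<longlongrightarrow> G z p) (at z within S)"
      using contz[OF p(1)] z by (simp add: continuous_on_def)
    ultimately have "\<forall>\<^sub>F w in at z within S. 0 < G w p"
      by (metis order_tendstoD(1))
    moreover have "\<forall>\<^sub>F w in at z within S. w \<in> S"
      by (simp add: eventually_at_filter)
    ultimately show "\<forall>\<^sub>F w in at z within S. \<psi> w < c"
    proof eventually_elim
      case (elim w)
      then show ?case
        using less_iff(2)[of w p] p(1) by (simp add: p_def)
    qed
  qed
  with \<psi> zero show thesis
    using that by blast
qed

text \<open>The line \<open>p \<mapsto> (x, p, q)\<close> stays inside
  \<open>X \<times> UNIV\<close> even when \<open>x\<close> is a boundary point of \<open>X\<close>.
  So the chain rule turns the derivative within that set into a two-sided derivative in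
  \<open>p\<close>, namely \<open>F'\<close> evaluated at \<open>(0, 1, 0)\<close>, which inherits
  the continuity of \<open>F'\<close>.\<close>

lemma C1_on_real_partial:
  fixes F :: "real \<times> real \<times> real \<Rightarrow> real"
  assumes "C1_on F (X \<times> UNIV)"
  obtains D where "continuous_on (X \<times> UNIV) D"
    and "\<And>x p q. x \<in> X \<Longrightarrow> ((\<lambda>p. F (x, p, q)) has_real_derivative D (x, p, q)) (at p)"
proof -
  obtain F' where F': "\<And>z. z \<in> X \<times> UNIV \<Longrightarrow>
      (F has_derivative blinfun_apply (F' z)) (at z within X \<times> UNIV)"
    and cont: "continuous_on (X \<times> UNIV) F'"
    using assms unfolding C1_on_def by blast
  have "((\<lambda>p. F (x, p, q)) has_real_derivative blinfun_apply (F' (x, p, q)) (0, 1, 0)) (at p)"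
    if x: "x \<in> X" for x p q
  proof -
    have "((\<lambda>p. (x, p, q)) has_vector_derivative (0, 1, 0)) (at p within UNIV)"
      unfolding has_vector_derivative_def by (auto intro!: derivative_eq_intros)
    moreover have "(F has_derivative blinfun_apply (F' (x, p, q)))
        (at (x, p, q) within range (\<lambda>p. (x, p, q)))"
      by (rule has_derivative_subset[OF F']) (use x in auto)
    ultimately show ?thesis
      using vector_derivative_diff_chain_within[of "\<lambda>p. (x, p, q)" "(0, 1, 0)" p UNIV F]
      by (simp add: has_real_derivative_iff_has_vector_derivative o_def)
  qed
  moreover have "continuous_on (X \<times> UNIV) (\<lambda>z. blinfun_apply (F' z) (0, 1, 0))"
    by (intro continuous_intros cont)
  ultimately show thesis
    using that by blast
qed

theorem theorem2:
  fixes a b x0 p0 q0 :: real and F :: "real \<times> real \<times> real \<Rightarrow> real"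
  assumes "a < b"
    and "C1_on F ({a..b} \<times> UNIV)"
    and "x0 \<in> {a<..<b}"
    and "F (x0, p0, q0) = 0"
    and "deriv (\<lambda>p. F (x0, p, q0)) p0 \<noteq> 0"
  shows "\<exists>\<delta> \<rho> (\<psi> :: real \<times> real \<Rightarrow> real).
      \<delta> > 0 \<and> \<rho> > 0 \<and> {x0 - \<delta>..x0 + \<delta>} \<subseteq> {a..b} \<and>
      continuous_on ({x0 - \<delta>..x0 + \<delta>} \<times> {q0 - \<rho>..q0 + \<rho>}) \<psi> \<and>
      \<psi> (x0, q0) = p0 \<and>
      (\<forall>x\<in>{x0 - \<delta>..x0 + \<delta>}. \<forall>q\<in>{q0 - \<rho>..q0 + \<rho>}. F (x, \<psi> (x, q), q) = 0) \<and>
      (\<forall>\<sigma> u u'. 0 < \<sigma> \<and> \<sigma> < \<delta> \<and>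
          C1_on u {x0 - \<sigma>..x0 + \<sigma>} \<and>
          (\<forall>x\<in>{x0 - \<sigma>..x0 + \<sigma>}.
             (u has_real_derivative u' x) (at x within {x0 - \<sigma>..x0 + \<sigma>})) \<and>
          (\<forall>x\<in>{x0 - \<sigma>..x0 + \<sigma>}.
             u' x \<in> {q0 - \<rho>..q0 + \<rho>} \<and> u x = \<psi> (x, u' x)) \<and>
          u' x0 = q0
        \<longrightarrow> (\<forall>x\<in>{x0 - \<sigma>..x0 + \<sigma>}. F (x, u x, u' x) = 0))"
proof -
  obtain D where contD: "continuous_on ({a..b} \<times> UNIV) D"
    and D: "\<And>x p q. x \<in> {a..b} \<Longrightarrow> ((\<lambda>p. F (x, p, q)) has_real_derivative D (x, p, q)) (at p)"
    using C1_on_real_partial[OF assms(2)] by blast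
  have contF: "continuous_on ({a..b} \<times> UNIV) F"
    using assms(2) unfolding C1_on_def
    by (meson has_derivative_continuous continuous_on_eq_continuous_within)
  have x0: "x0 \<in> {a..b}"
    using assms(3) by auto
  \<comment> \<open>Multiplying by the sign reduces both cases to a positive partial derivative; as
    \<open>s \<noteq> 0\<close>, the zeros of \<open>F\<close> are unchanged.\<close>
  define s where "s = sgn (D (x0, p0, q0))"
  have "D (x0, p0, q0) \<noteq> 0"
    using DERIV_imp_deriv[OF D[OF x0, of q0 p0]] assms(5) by simp
  then have "s \<noteq> 0" and s_pos: "0 < s * D (x0, p0, q0)"
    by (auto simp: s_def sgn_real_def)
  have "((\<lambda>z. s * D z) \<longlongrightarrow> s * D (x0, p0, q0)) (at (x0, p0, q0) within {a..b} \<times> UNIV)"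
    using contD x0 by (intro tendsto_intros) (auto simp: continuous_on_def)
  then have "\<forall>\<^sub>F z in at (x0, p0, q0) within {a..b} \<times> UNIV. 0 < s * D z"
    using s_pos by (rule order_tendstoD)
  \<comment> \<open>\<open>eventually_at\<close> says nothing about the centre itself;
    \<open>s_pos\<close> supplies the inequality there.\<close>
  then obtain r where "r > 0"
    and r: "\<And>z. z \<in> {a..b} \<times> UNIV \<Longrightarrow> dist z (x0, p0, q0) < r \<Longrightarrow> 0 < s * D z"
    using s_pos unfolding eventually_at by (metis UNIV_I)
  \<comment> \<open>In the cube of half-side \<open>e\<close> the distance to the centre is at most
    the sum of three coordinate differences, hence at most \<open>3 * r / 4 < r\<close>. The other
    two bounds keep \<open>x\<close> in \<open>{a..b}\<close>.\<close>
  define e where "e = min (r / 4) (min (x0 - a) (b - x0))"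
  have e: "0 < e" "e \<le> r / 4" "e \<le> x0 - a" "e \<le> b - x0"
    using \<open>r > 0\<close> assms(3) by (auto simp: e_def min_def)
  define G where "G = (\<lambda>z p. s * F (fst z, p, snd z))"
  have box: "0 < s * D (x, p, q)"
    if "x \<in> {x0 - e..x0 + e}" "p \<in> {p0 - e..p0 + e}" "q \<in> {q0 - e..q0 + e}" for x p q
  proof (rule r)
    have "dist (x, p, q) (x0, p0, q0) \<le> \<bar>x - x0\<bar> + (\<bar>p - p0\<bar> + \<bar>q - q0\<bar>)"
      using norm_Pair_le[of "x - x0" "(p - p0, q - q0)"] norm_Pair_le[of "p - p0" "q - q0"]
      by (simp add: dist_norm)
    also have "\<dots> < r"
      using that e \<open>r > 0\<close> by (auto simp: abs_le_iff)
    finally show "dist (x, p, q) (x0, p0, q0) < r" .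
  qed (use that e in auto)
  have mono: "strict_mono_on {p0 - e..p0 + e} (G z)"
    if "z \<in> {x0 - e..x0 + e} \<times> {q0 - e..q0 + e}" for z
  proof (rule strict_mono_onI)
    fix p p' assume "p \<in> {p0 - e..p0 + e}" "p' \<in> {p0 - e..p0 + e}" "p < p'"
    moreover have "(G z has_real_derivative s * D (fst z, t, snd z)) (at t)" for t
      unfolding G_def by (rule DERIV_cmult, rule D) (use that e in auto)
    ultimately show "G z p < G z p'"
      using that by (intro DERIV_pos_imp_increasing[of p p' "G z"]) (fastforce intro: box)+
  qed
  have contG: "continuous_on ({a..b} \<times> UNIV) (\<lambda>z. G z p)" for p
    unfolding G_def
    by (intro continuous_intros continuous_on_compose2[OF contF]) auto
  have G0: "G (x0, q0) p0 = 0"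
    by (simp add: G_def assms(4))
  have G0_signs: "G (x0, q0) (p0 - e) < 0" "0 < G (x0, q0) (p0 + e)"
    using strict_mono_onD[OF mono, of "(x0, q0)" "p0 - e" p0]
      strict_mono_onD[OF mono, of "(x0, q0)" p0 "p0 + e"] G0 e(1) by auto
  have "((\<lambda>z. G z p) \<longlongrightarrow> G (x0, q0) p) (at (x0, q0) within {a..b} \<times> UNIV)" for p
    using contG x0 by (simp add: continuous_on_def)
  then have "\<forall>\<^sub>F z in at (x0, q0) within {a..b} \<times> UNIV. G z (p0 - e) < 0 \<and> 0 < G z (p0 + e)"
    using G0_signs by (intro eventually_conj order_tendstoD)
  \<comment> \<open>As for \<open>r\<close>, the centre is covered separately, here by
    \<open>G0_signs\<close>.\<close>
  then obtain d where "d > 0"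
    and d: "\<And>z. z \<in> {a..b} \<times> UNIV \<Longrightarrow> dist z (x0, q0) < d \<Longrightarrow> G z (p0 - e) < 0 \<and> 0 < G z (p0 + e)"
    using G0_signs unfolding eventually_at by (metis UNIV_I)
  \<comment> \<open>The bound \<open>e\<close> preserves monotonicity on the smaller square, and
    \<open>d / 3\<close> preserves the signs at \<open>p0 - e\<close> and \<open>p0 + e\<close>,
    since two coordinate differences add up to at most \<open>2 * d / 3 < d\<close>.\<close>
  define \<delta> where "\<delta> = min e (d / 3)"
  have \<delta>: "0 < \<delta>" "\<delta> \<le> e" "\<delta> \<le> d / 3"
    using e \<open>d > 0\<close> by (auto simp: \<delta>_def min_def)
  let ?S = "{x0 - \<delta>..x0 + \<delta>} \<times> {q0 - \<delta>..q0 + \<delta>}"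
  have sub: "?S \<subseteq> {x0 - e..x0 + e} \<times> {q0 - e..q0 + e}" "?S \<subseteq> {a..b} \<times> UNIV"
    using \<delta> e by auto
  have signs: "G z (p0 - e) < 0 \<and> 0 < G z (p0 + e)" if "z \<in> ?S" for z
  proof (rule d)
    have "dist z (x0, q0) \<le> \<bar>fst z - x0\<bar> + \<bar>snd z - q0\<bar>"
      using norm_Pair_le[of "fst z - x0" "snd z - q0"] by (cases z) (simp add: dist_norm)
    also have "\<dots> < d"
      using that \<delta> \<open>d > 0\<close> by (auto simp: abs_le_iff)
    finally show "dist z (x0, q0) < d" .
  qed (use that sub in blast)
  obtain \<psi> where cont\<psi>: "continuous_on ?S \<psi>"
    and \<psi>: "\<And>z. z \<in> ?S \<Longrightarrow> \<psi> z \<in> {p0 - e<..<p0 + e}"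
    and zero: "\<And>z. z \<in> ?S \<Longrightarrow> G z (\<psi> z) = 0"
  proof (rule strict_mono_implicit_function[of "p0 - e" "p0 + e" ?S G])
    show "continuous_on ?S (\<lambda>z. G z p)" for p
      using contG sub(2) continuous_on_subset by blast
    show "continuous_on {p0 - e..p0 + e} (G z)" if "z \<in> ?S" for z
      unfolding G_def using that sub(2)
      by (intro continuous_intros continuous_on_compose2[OF contF]) auto
  qed (use e mono signs sub in auto)
  have F0: "F (x, \<psi> (x, q), q) = 0"
    if "x \<in> {x0 - \<delta>..x0 + \<delta>}" "q \<in> {q0 - \<delta>..q0 + \<delta>}" for x q
    using zero[of "(x, q)"] that \<open>s \<noteq> 0\<close> by (simp add: G_def)
  have "(x0, q0) \<in> ?S"
    using \<delta> by simp
  \<comment> \<open>Both values are zeros of the injective function \<open>G (x0, q0)\<close> on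
    \<open>{p0 - e..p0 + e}\<close>.\<close>
  then have "\<psi> (x0, q0) = p0"
    using strict_mono_on_eqD[OF mono, of "(x0, q0)" "\<psi> (x0, q0)" p0] \<psi>[of "(x0, q0)"]
      zero[of "(x0, q0)"] G0 sub(1) e(1) by fastforce
  moreover have "{x0 - \<delta>..x0 + \<delta>} \<subseteq> {a..b}"
    using \<delta> e by auto
  \<comment> \<open>The same \<open>\<delta>\<close> is the witness for \<open>\<rho>\<close>. For a
    solution \<open>u\<close>, \<open>F0\<close> is applied at \<open>(x, u' x)\<close>, which lies
    in the square because \<open>\<sigma> < \<delta>\<close> and \<open>u' x\<close> is confined to
    the \<open>\<rho>\<close>-interval.\<close>
  ultimately show ?thesis
    using \<delta>(1) cont\<psi> F0
    by (intro exI[of _ \<delta>] exI[of _ \<psi>] conjI ballI allI impI) (auto simp: less_imp_le)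
qed

end
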